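(* Let $$a(\lambda)=a_0(\lambda-\alpha_1)^{m_1}\cdots(\lambda-\alpha_s)^{m_s},\qquad b(\lambda)=b_0(\lambda-\beta_1)^{n_1}\cdots(\lambda-\beta_t)^{n_t}$$ be complex polynomials of degrees $m=m_1+\dots+m_s\ge1$ and $n=n_1+\dots+n_t\ge1$, with $a_0b_0\ne0$, all $m_k>0$ and $n_\ell>0$, $\alpha_1,\dots,\alpha_s$ pairwise different, and $\beta_1,\dots,\beta_t$ pairwise different, and let $c(\lambda)$ be a complex polynomial of degree at most $m+n-1$. Let $S(a,b)$ be the Sylvester matrix of $a$ and $b$. If $\det S(a,b)\ne0$, then the equation $$a(\lambda)x(\lambda)+b(\lambda)y(\lambda)=c(\lambda)$$ in polynomials $x$ of degree at most $n-1$ and $y$ of degree at most $m-1$ has the following solution: $x(\lambda)$ is the general Hermite interpolation polynomial for the function $c(\lambda)/a(\lambda)$ over the set of zeros (with their multiplicities) of $b(\lambda)$, and $y(\lambda)$ is the general Hermite interpolation polynomial for the function $c(\lambda)/b(\lambda)$ over the set of zeros (with their multiplicities) of $a(\lambda)$.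
   Context: Sylvester matrix: writing $a(\lambda)=a_0\lambda^m+a_1\lambda^{m-1}+\dots+a_m$ and $b(\lambda)=b_0\lambda^n+b_1\lambda^{n-1}+\dots+b_n$, $S(a,b)$ is the $(m+n)\times(m+n)$ matrix whose first $n$ rows are the successive right shifts of $[a_0,a_1,\dots,a_m,0,\dots,0]$ (row $p$, $1\le p\le n$, has $p-1$ zeros, then $a_0,\dots,a_m$, then $n-p$ zeros), and whose last $m$ rows are the successive right shifts of $[b_0,b_1,\dots,b_n,0,\dots,0]$ (row $n+p$, $1\le p\le m$, has $p-1$ zeros, then $b_0,\dots,b_n$, then $m-p$ zeros). General Hermite interpolation: for a complex function $f$ having, at each $\alpha_k$, derivatives up to order $m_k-1$, the general Hermite interpolation polynomial for $f$ over the zeros of $a$ with their multiplicities is the unique polynomial $p$ of degree no larger than $m-1$ such that $p$ and its first $m_k-1$ derivatives take the same values at $\alpha_k$ as $f$ and its first $m_k-1$ derivatives, for every $k=1,\dots,s$. The interpolation polynomial over the zeros of $b$ (of degree no larger than $n-1$) is defined in the same way using $\beta_\ell$ and $n_\ell$. *)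

theory Defs
  imports
    "HOL-Analysis.Analysis"
    "Subresultants.Resultant_Prelim"
begin

text \<open>
  The matrix $S(a,b)$ is \<^const>\<open>sylvester_mat\<close>: with $m$, $n$ the degrees of $a$, $b$, its rows
  $0,\dots,n-1$ hold the shifted coefficients of $a$ and its rows $n,\dots,m+n-1$ those of $b$,
  leading coefficients first. The unqualified name \<open>det\<close> is ambiguous between the two matrix
  libraries; \<open>Determinant.det\<close> is the one for matrices with explicit dimensions.
\<close>

text \<open>
  \<open>has_derivs_upto r f z\<close>: the derivatives of $f$ of the orders $1,\dots,r$ exist at $z$.
  A derivative of order at least 2 at $z$ presupposes that the preceding one exists near $z$;
  this must be required explicitly because \<^const>\<open>deriv\<close> is a total function.
\<close>

primrec has_derivs_upto :: "nat \<Rightarrow> (complex \<Rightarrow> complex) \<Rightarrow> complex \<Rightarrow> bool" where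
  "has_derivs_upto 0 f z \<longleftrightarrow> True"
| "has_derivs_upto (Suc r) f z \<longleftrightarrow>
     f field_differentiable (at z) \<and>
     (r > 0 \<longrightarrow> (\<forall>\<^sub>F w in nhds z. f field_differentiable (at w))) \<and>
     has_derivs_upto r (deriv f) z"

text \<open>
  In the following, the nodes are $\alpha_1,\dots,\alpha_s$, and \<open>\<mu> k\<close> is the multiplicity of
  $\alpha_k$.
\<close>

definition hermite_conditions ::
    "nat \<Rightarrow> (nat \<Rightarrow> complex) \<Rightarrow> (nat \<Rightarrow> nat) \<Rightarrow> (complex \<Rightarrow> complex) \<Rightarrow> complex poly \<Rightarrow> bool" where
  "hermite_conditions s \<alpha> \<mu> f p \<longleftrightarrow>
     Polynomial.degree p \<le> (\<Sum>k=1..s. \<mu> k) - 1 \<and>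
     (\<forall>k\<in>{1..s}. \<forall>j\<le>\<mu> k - 1. (deriv ^^ j) (poly p) (\<alpha> k) = (deriv ^^ j) f (\<alpha> k))"

definition is_hermite_interpolation_poly ::
    "nat \<Rightarrow> (nat \<Rightarrow> complex) \<Rightarrow> (nat \<Rightarrow> nat) \<Rightarrow> (complex \<Rightarrow> complex) \<Rightarrow> complex poly \<Rightarrow> bool" where
  "is_hermite_interpolation_poly s \<alpha> \<mu> f p \<longleftrightarrow>
     (\<forall>k\<in>{1..s}. has_derivs_upto (\<mu> k - 1) f (\<alpha> k)) \<and>
     hermite_conditions s \<alpha> \<mu> f p \<and>
     (\<forall>q. hermite_conditions s \<alpha> \<mu> f q \<longrightarrow> q = p)"

end

theory Submission
  imports
    Defs
    "HOL-Complex_Analysis.Complex_Analysis"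
    "HOL-Computational_Algebra.Field_as_Ring"
    "Subresultants.Subresultant_Gcd"
begin

text \<open>
  A nonzero resultant makes $a$ and $b$ coprime, so reducing a Bezout identity modulo $b$ solves
  $ax + by = c$ within the degree bounds. At a zero $\beta$ of $b$ of multiplicity $\nu$ we have
  $c/a - x = by/a$, and the right-hand side is $(z-\beta)^\nu$ times a function holomorphic near
  $\beta$; hence $x$ satisfies the interpolation conditions.
\<close>

lemma coprime_if_det_sylvester_mat_nonzero:
  fixes p q :: "'a :: field_gcd poly"
  assumes "p \<noteq> 0" "Determinant.det (sylvester_mat p q) \<noteq> 0"
  shows "coprime p q"
proof -
  have "Polynomial.degree (gcd p q) = 0"
    using assms(2) resultant_0_gcd[of p q] by (simp add: resultant_def)
  \<comment> \<open>The zero polynomial also has degree 0; \<open>p \<noteq> 0\<close> rules it out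
    as the gcd.\<close>
  then have "is_unit (gcd p q)"
    using assms(1) by (simp add: is_unit_iff_degree)
  then show ?thesis
    by (simp only: is_unit_gcd)
qed

text \<open>Scaling a Bezout identity by \<open>r\<close> and reducing the coefficient of
  \<open>p\<close> modulo \<open>q\<close> bounds \<open>x\<close>; the discarded quotient is moved
  into \<open>y\<close>. The bound on \<open>y\<close> is then forced by comparing degrees in
  \<open>q * y = r - p * x\<close>.\<close>

lemma bezout_with_degree_bounds:
  fixes p q r :: "'a :: field_gcd poly"
  assumes "coprime p q" "Polynomial.degree p \<ge> 1" "Polynomial.degree q \<ge> 1"
    and r: "Polynomial.degree r \<le> Polynomial.degree p + Polynomial.degree q - 1"
  obtains x y where "Polynomial.degree x \<le> Polynomial.degree q - 1"
    "Polynomial.degree y \<le> Polynomial.degree p - 1" "p * x + q * y = r"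
proof -
  obtain u v where uv: "u * p + v * q = 1"
    using bezout_coefficients_fst_snd[of p q] \<open>coprime p q\<close> by (metis coprime_imp_gcd_eq_1)
  define x where "x = (u * r) mod q"
  define y where "y = v * r + p * ((u * r) div q)"
  have "p * x + q * y = p * (x + q * ((u * r) div q)) + v * q * r"
    by (simp add: y_def algebra_simps)
  also have "x + q * ((u * r) div q) = u * r"
    by (simp add: x_def)
  also have "p * (u * r) + v * q * r = (u * p + v * q) * r"
    by (simp add: algebra_simps)
  finally have eq: "p * x + q * y = r"
    using uv by simp
  have q0: "q \<noteq> 0" using assms(3) by auto
  have dx: "Polynomial.degree x \<le> Polynomial.degree q - 1"
    using degree_mod_less[OF q0, of "u * r"] assms(3) unfolding x_def by auto
  have "Polynomial.degree (p * x) \<le> Polynomial.degree p + Polynomial.degree q - 1"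
    using degree_mult_le[of p x] dx assms(3) by linarith
  then have "Polynomial.degree (r - p * x) \<le> Polynomial.degree p + Polynomial.degree q - 1"
    using r by (rule degree_diff_le[rotated])
  moreover have "q * y = r - p * x"
    using eq by (simp add: algebra_simps)
  ultimately have "Polynomial.degree (q * y) \<le> Polynomial.degree p + Polynomial.degree q - 1"
    by simp
  then have "Polynomial.degree y \<le> Polynomial.degree p - 1"
    \<comment> \<open>Degrees add only for nonzero factors; \<open>y = 0\<close> has degree 0 by
      convention.\<close>
    using q0 assms(2) by (cases "y = 0") (auto simp: degree_mult_eq)
  then show thesis
    using that dx eq by blast
qed

lemma has_derivs_upto_if_holomorphic_on:
  assumes "f holomorphic_on S" "open S" "z \<in> S"
  shows "has_derivs_upto r f z"
  using assms(1)
proof (induction r arbitrary: f)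
  case (Suc r)
  have "f field_differentiable (at w)" if "w \<in> S" for w
    using Suc.prems assms(2) that holomorphic_on_imp_differentiable_at by blast
  then show ?case
    using Suc assms(2,3) holomorphic_deriv[of f S] eventually_nhds_in_open[of S z]
    by (auto elim: eventually_mono)
qed simp

text \<open>Each differentiation lowers the exponent of \<open>w - z\<close> by only one and leaves
  a holomorphic cofactor, so a positive power survives after \<open>j < N\<close> steps. The
  factorization is assumed on all of \<open>S\<close>, not just at \<open>z\<close>, so that it can
  be differentiated.\<close>

lemma higher_deriv_power_mult_eq_0:
  fixes z :: complex
  assumes "open S" "z \<in> S" "g holomorphic_on S"
    and "\<And>w. w \<in> S \<Longrightarrow> h w = (w - z) ^ N * g w" "j < N"
  shows "(deriv ^^ j) h z = 0"
  using assms(3-5)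
proof (induction j arbitrary: N g h)
  case 0
  then show ?case using assms(2) by simp
next
  case (Suc j)
  obtain M where N: "N = Suc M" using Suc.prems(3) by (cases N) auto
  \<comment> \<open>This is the cofactor left when \<open>(w - z) ^ M\<close> is taken out of the
    product rule.\<close>
  define g' where "g' = (\<lambda>w. of_nat (Suc M) * g w + (w - z) * deriv g w)"
  have "deriv h w = (w - z) ^ M * g' w" if w: "w \<in> S" for w
  proof -
    have "(g has_field_derivative deriv g w) (at w)"
      using Suc.prems(1) assms(1) w by (rule holomorphic_derivI)
    moreover have "((\<lambda>w. w - z) has_field_derivative 1) (at w)"
      by (auto intro!: derivative_eq_intros)
    then have "((\<lambda>w. (w - z) ^ N) has_field_derivative of_nat (Suc M) * (w - z) ^ M) (at w)"
      using DERIV_power[of "\<lambda>w. w - z" 1 w UNIV "Suc M"] by (simp add: N)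
    ultimately have "((\<lambda>w. (w - z) ^ N * g w) has_field_derivative
        of_nat (Suc M) * (w - z) ^ M * g w + deriv g w * (w - z) ^ N) (at w)"
      by (rule DERIV_mult[rotated])
    then have "deriv (\<lambda>w. (w - z) ^ N * g w) w =
        of_nat (Suc M) * (w - z) ^ M * g w + deriv g w * (w - z) ^ N"
      by (rule DERIV_imp_deriv)
    also have "\<dots> = (w - z) ^ M * g' w"
      unfolding g'_def N by (simp only: power_Suc distrib_left mult_ac)
    finally have "deriv (\<lambda>w. (w - z) ^ N * g w) w = (w - z) ^ M * g' w" .
    \<comment> \<open>\<open>h\<close> is known only on \<open>S\<close>; agreement near
      \<open>w\<close> suffices, since \<open>deriv\<close> is local.\<close>
    moreover have "\<forall>\<^sub>F v in nhds w. h v = (v - z) ^ N * g v"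
      using eventually_nhds_in_open[OF assms(1) w] Suc.prems(2) by (auto elim: eventually_mono)
    then have "deriv h w = deriv (\<lambda>v. (v - z) ^ N * g v) w"
      by (rule deriv_cong_ev) simp
    ultimately show ?thesis by simp
  qed
  moreover have "g' holomorphic_on S"
    unfolding g'_def using Suc.prems(1) assms(1) by (auto intro!: holomorphic_intros)
  ultimately have "(deriv ^^ j) (deriv h) z = 0"
    using Suc.IH[of g' "deriv h" M] Suc.prems(3) N by simp
  then show ?case by (simp add: funpow_swap1)
qed

text \<open>By induction the derivative is divisible by one power less, and at a root the order of a
  nonzero polynomial exceeds that of its derivative by exactly one.\<close>

lemma power_linear_dvd_if_higher_deriv_eq_0:
  fixes p :: "complex poly"
  assumes "\<And>j. j < N \<Longrightarrow> (deriv ^^ j) (poly p) z = 0"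
  shows "[:- z, 1:] ^ N dvd p"
  using assms
proof (induction N arbitrary: p)
  case (Suc N)
  have "deriv (poly p) = poly (pderiv p)"
    by (intro ext DERIV_imp_deriv poly_DERIV)
  then have dvd: "[:- z, 1:] ^ N dvd pderiv p"
    using Suc.prems[of "Suc _"] by (intro Suc.IH) (simp add: funpow_swap1)
  have root: "poly p z = 0"
    using Suc.prems[of 0] by simp
  show ?case
  proof (cases "p = 0")
    case False
    \<comment> \<open>In characteristic 0 a vanishing derivative makes \<open>p\<close> constant,
      and a constant with a root is 0.\<close>
    then have "pderiv p \<noteq> 0"
      using root by (auto dest!: pderiv_iszero)
    then have "N \<le> Polynomial.order z (pderiv p)"
      using order_divides[THEN iffD1, OF dvd] by blast
    then show ?thesis
      using order_pderiv[OF False root] by (intro order_divides[THEN iffD2]) simp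
  qed simp
qed simp

lemma coprime_linear_poly:
  fixes u v :: "'a :: field_gcd"
  assumes "u \<noteq> v"
  shows "coprime [:- u, 1:] [:- v, 1:]"
proof (rule coprimeI)
  fix d assume "d dvd [:- u, 1:]" "d dvd [:- v, 1:]"
  then have "d dvd [:- u, 1:] - [:- v, 1:]"
    by (rule dvd_diff)
  \<comment> \<open>The difference is the nonzero constant \<open>v - u\<close>.\<close>
  moreover have "is_unit ([:- u, 1:] - [:- v, 1:])"
    using assms by (simp add: is_unit_iff_degree)
  ultimately show "is_unit d"
    by (rule dvd_unit_imp_unit)
qed

lemma prod_power_linear_dvd:
  fixes p :: "'a :: field_gcd poly"
  assumes "finite A" "inj_on \<alpha> A" "\<And>k. k \<in> A \<Longrightarrow> [:- \<alpha> k, 1:] ^ \<mu> k dvd p"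
  shows "(\<Prod>k\<in>A. [:- \<alpha> k, 1:] ^ \<mu> k) dvd p"
  using assms
proof (induction A rule: finite_induct)
  case (insert i A)
  have "coprime ([:- \<alpha> i, 1:] ^ \<mu> i) (\<Prod>k\<in>A. [:- \<alpha> k, 1:] ^ \<mu> k)"
    using insert.hyps insert.prems(1)
    by (intro prod_coprime_right coprime_power_left_iff[THEN iffD2] disjI1
        coprime_power_right_iff[THEN iffD2] coprime_linear_poly) auto
  then show ?case
    using insert by (auto intro: divides_mult)
qed simp

lemma degree_prod_power_linear:
  fixes \<alpha> :: "'b \<Rightarrow> 'a :: field"
  shows "Polynomial.degree (\<Prod>k\<in>A. [:- \<alpha> k, 1:] ^ \<mu> k) = (\<Sum>k\<in>A. \<mu> k)"
  by (subst degree_prod_eq_sum_degree) (auto simp: degree_power_eq)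

text \<open>The difference of two solutions vanishes at each node to the prescribed order, so the
  product of all the linear powers divides it; the degree of that product is too large unless the
  difference is 0.\<close>

lemma hermite_conditions_unique:
  assumes "hermite_conditions s \<alpha> \<mu> f p" "hermite_conditions s \<alpha> \<mu> f q"
    and "inj_on \<alpha> {1..s}" "(\<Sum>k=1..s. \<mu> k) \<ge> 1"
  shows "p = q"
proof (rule ccontr)
  assume "p \<noteq> q"
  have "[:- \<alpha> k, 1:] ^ \<mu> k dvd p - q" if k: "k \<in> {1..s}" for k
  proof (rule power_linear_dvd_if_higher_deriv_eq_0)
    fix j assume "j < \<mu> k"
    then have "j \<le> \<mu> k - 1" by simp
    then have "(deriv ^^ j) (poly p) (\<alpha> k) = (deriv ^^ j) (poly q) (\<alpha> k)"
      using assms(1,2) k unfolding hermite_conditions_def by metis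
    then show "(deriv ^^ j) (poly (p - q)) (\<alpha> k) = 0"
      using higher_deriv_diff[of "poly p" UNIV "poly q" "\<alpha> k" j]
      by (simp add: poly_diff[abs_def] holomorphic_intros)
  qed
  then have "(\<Prod>k=1..s. [:- \<alpha> k, 1:] ^ \<mu> k) dvd p - q"
    using assms(3) by (intro prod_power_linear_dvd) auto
  then have "Polynomial.degree (\<Prod>k=1..s. [:- \<alpha> k, 1:] ^ \<mu> k) \<le> Polynomial.degree (p - q)"
    using \<open>p \<noteq> q\<close> by (intro dvd_imp_degree_le) simp_all
  then have "(\<Sum>k=1..s. \<mu> k) \<le> Polynomial.degree (p - q)"
    by (simp only: degree_prod_power_linear)
  moreover have "Polynomial.degree (p - q) \<le> (\<Sum>k=1..s. \<mu> k) - 1"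
    using assms(1,2) unfolding hermite_conditions_def by (intro degree_diff_le) auto
  \<comment> \<open>A positive sum makes the truncated subtraction a strict decrease.\<close>
  ultimately show False
    using assms(4) by simp
qed

text \<open>Serves both interpolation problems: the nodes are the zeros of one polynomial, and
  \<open>a\<close> stands for the other one, which is nonzero there.\<close>

lemma is_hermite_interpolation_poly_quotient:
  assumes dvd: "\<And>k. k \<in> {1..s} \<Longrightarrow> [:- \<alpha> k, 1:] ^ \<mu> k dvd c - a * x"
    and nz: "\<And>k. k \<in> {1..s} \<Longrightarrow> poly a (\<alpha> k) \<noteq> 0"
    and pos: "\<And>k. k \<in> {1..s} \<Longrightarrow> \<mu> k > 0"
    and inj: "inj_on \<alpha> {1..s}"
    and sum: "(\<Sum>k=1..s. \<mu> k) \<ge> 1"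
    and deg: "Polynomial.degree x \<le> (\<Sum>k=1..s. \<mu> k) - 1"
  shows "is_hermite_interpolation_poly s \<alpha> \<mu> (\<lambda>z. poly c z / poly a z) x"
proof -
  define S where "S = - {z. poly a z = 0}"
  define f where "f = (\<lambda>z. poly c z / poly a z)"
  have S: "open S"
  proof -
    have "closed {z. poly a z = 0}"
      by (intro closed_Collect_eq continuous_intros)
    then show ?thesis unfolding S_def by (rule open_Compl)
  qed
  have f: "f holomorphic_on S"
    unfolding f_def S_def by (auto intro!: holomorphic_intros)
  have eq: "(deriv ^^ j) (poly x) (\<alpha> k) = (deriv ^^ j) f (\<alpha> k)"
    if k: "k \<in> {1..s}" and j: "j < \<mu> k" for k j
  proof -
    have kS: "\<alpha> k \<in> S" using nz k by (simp add: S_def)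
    obtain d where d: "c - a * x = [:- \<alpha> k, 1:] ^ \<mu> k * d"
      using dvd[OF k] by (auto elim: dvdE)
    \<comment> \<open>Dividing \<open>c - a * x\<close> by \<open>a\<close> shows that the error is
      \<open>(z - \<alpha> k) ^ \<mu> k\<close> times \<open>d / a\<close>, which is holomorphic off
      the zeros of \<open>a\<close>.\<close>
    have "(deriv ^^ j) (\<lambda>z. f z - poly x z) (\<alpha> k) = 0"
    proof (rule higher_deriv_power_mult_eq_0[OF S kS _ _ j])
      show "(\<lambda>z. poly d z / poly a z) holomorphic_on S"
        unfolding S_def by (auto intro!: holomorphic_intros)
      show "f w - poly x w = (w - \<alpha> k) ^ \<mu> k * (poly d w / poly a w)" if "w \<in> S" for w
      proof -
        have "poly c w - poly a w * poly x w = (w - \<alpha> k) ^ \<mu> k * poly d w"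
          using arg_cong[OF d, of "\<lambda>p. poly p w"] by simp
        moreover have "f w - poly x w = (poly c w - poly a w * poly x w) / poly a w"
          using that by (simp add: f_def S_def diff_divide_distrib)
        ultimately show ?thesis by simp
      qed
    qed
    then show ?thesis
      using higher_deriv_diff[OF f _ S kS, of "poly x" j] by (simp add: holomorphic_intros)
  qed
  have "hermite_conditions s \<alpha> \<mu> f x"
    unfolding hermite_conditions_def
  proof (intro conjI ballI allI impI)
    fix k j assume "k \<in> {1..s}" "j \<le> \<mu> k - 1"
    then show "(deriv ^^ j) (poly x) (\<alpha> k) = (deriv ^^ j) f (\<alpha> k)"
      \<comment> \<open>With \<open>\<mu> k = 0\<close>, truncation would still admit
        \<open>j = 0\<close>; positivity gives \<open>j < \<mu> k\<close>.\<close>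
      using eq pos[of k] by simp
  qed (rule deg)
  moreover have "has_derivs_upto (\<mu> k - 1) f (\<alpha> k)" if "k \<in> {1..s}" for k
    using has_derivs_upto_if_holomorphic_on[OF f S] nz[OF that] by (simp add: S_def)
  ultimately show ?thesis
    using hermite_conditions_unique[OF _ _ inj sum]
    unfolding is_hermite_interpolation_poly_def f_def by blast
qed

theorem corollary3:
  fixes a b c :: "complex poly"
    and a0 b0 :: complex
    and s t m n :: nat
    and \<alpha> \<beta> :: "nat \<Rightarrow> complex"
    and \<mu> \<nu> :: "nat \<Rightarrow> nat"
  assumes a: "a = Polynomial.smult a0 (\<Prod>k=1..s. [:- \<alpha> k, 1:] ^ \<mu> k)"
    and b: "b = Polynomial.smult b0 (\<Prod>l=1..t. [:- \<beta> l, 1:] ^ \<nu> l)"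
    and m: "m = (\<Sum>k=1..s. \<mu> k)" "m \<ge> 1"
    and n: "n = (\<Sum>l=1..t. \<nu> l)" "n \<ge> 1"
    and lead: "a0 * b0 \<noteq> 0"
    and mult_a: "\<And>k. k \<in> {1..s} \<Longrightarrow> \<mu> k > 0"
    and mult_b: "\<And>l. l \<in> {1..t} \<Longrightarrow> \<nu> l > 0"
    and distinct_a: "inj_on \<alpha> {1..s}"
    and distinct_b: "inj_on \<beta> {1..t}"
    and c: "Polynomial.degree c \<le> m + n - 1"
    and det: "Determinant.det (sylvester_mat a b) \<noteq> 0"
  shows "(\<forall>l\<in>{1..t}. poly a (\<beta> l) \<noteq> 0) \<and> (\<forall>k\<in>{1..s}. poly b (\<alpha> k) \<noteq> 0) \<and>
    (\<exists>x y. is_hermite_interpolation_poly t \<beta> \<nu> (\<lambda>z. poly c z / poly a z) x \<and>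
           is_hermite_interpolation_poly s \<alpha> \<mu> (\<lambda>z. poly c z / poly b z) y \<and>
           Polynomial.degree x \<le> n - 1 \<and> Polynomial.degree y \<le> m - 1 \<and>
           a * x + b * y = c)"
proof -
  have a0: "a0 \<noteq> 0" and b0: "b0 \<noteq> 0" using lead by auto
  have deg: "Polynomial.degree a = m" "Polynomial.degree b = n"
    using a0 b0 by (simp_all only: a b m(1) n(1) degree_smult_eq degree_prod_power_linear if_False)
  have "a \<noteq> 0" using deg(1) m(2) by auto
  then have cop: "coprime a b"
    using det by (rule coprime_if_det_sylvester_mat_nonzero)
  have dvd_a: "[:- \<alpha> k, 1:] ^ \<mu> k dvd a" if "k \<in> {1..s}" for k
    unfolding a using that by (intro dvd_smult dvd_prodI) auto
  have dvd_b: "[:- \<beta> l, 1:] ^ \<nu> l dvd b" if "l \<in> {1..t}" for l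
    unfolding b using that by (intro dvd_smult dvd_prodI) auto
  \<comment> \<open>Positive multiplicities make the nodes actual roots; coprimality then keeps the
    other polynomial, the denominator, nonzero there.\<close>
  have "poly a (\<alpha> k) = 0" if "k \<in> {1..s}" for k
    using dvd_trans[OF dvd_power[OF disjI1[OF mult_a[OF that]]] dvd_a[OF that]]
    by (simp add: poly_eq_0_iff_dvd)
  then have nz_b: "poly b (\<alpha> k) \<noteq> 0" if "k \<in> {1..s}" for k
    using coprime_poly_0[OF cop] that by blast
  have "poly b (\<beta> l) = 0" if "l \<in> {1..t}" for l
    using dvd_trans[OF dvd_power[OF disjI1[OF mult_b[OF that]]] dvd_b[OF that]]
    by (simp add: poly_eq_0_iff_dvd)
  then have nz_a: "poly a (\<beta> l) \<noteq> 0" if "l \<in> {1..t}" for l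
    using coprime_poly_0[OF cop] that by blast
  obtain x y where xy: "Polynomial.degree x \<le> n - 1" "Polynomial.degree y \<le> m - 1"
      "a * x + b * y = c"
    using bezout_with_degree_bounds[OF cop, of c] deg m(2) n(2) c by auto
  \<comment> \<open>In this form each remainder inherits the linear powers dividing \<open>b\<close>
    or \<open>a\<close>.\<close>
  have rem: "c - a * x = b * y" "c - b * y = a * x"
    using xy(3) by (auto simp: algebra_simps)
  have "is_hermite_interpolation_poly t \<beta> \<nu> (\<lambda>z. poly c z / poly a z) x"
    using dvd_b nz_a mult_b distinct_b n xy(1)
    by (intro is_hermite_interpolation_poly_quotient) (auto simp: rem)
  moreover have "is_hermite_interpolation_poly s \<alpha> \<mu> (\<lambda>z. poly c z / poly b z) y"
    using dvd_a nz_b mult_a distinct_a m xy(2)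
    by (intro is_hermite_interpolation_poly_quotient) (auto simp: rem)
  ultimately show ?thesis
    using nz_a nz_b xy by blast
qed

end
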